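(* Given $T\in\mathbb N$, a clustering instance $\mathcal V=(V,d,k)$ with $|V|=n$, and a fixed set $C$ of initial centers, the number of discontinuities of $\beta\mapsto\mathtt{lloyds}_\beta(\mathcal V,C,T)$ (for $\beta\in[1,\infty)$) is $O(\min(n^{3T},n^{k+3}))$.
   Context: A clustering instance $\mathcal V=(V,d,k)$ consists of a finite point set $V$, a metric $d$, and a number of clusters $k$; each instance has an associated cost function on clusterings (e.g. Hamming distance to a target clustering). $\beta$-Lloyd's method from initial centers $C$: repeat: form the Voronoi partition $\{C_1,\dots,C_k\}$ of $V$ induced by $C$; replace the centers by $\arg\min_{x\in V}\sum_{v\in C_i}d(x,v)^\beta$ for each $i$; stop if the centers do not change. $\mathtt{lloyds}_\beta(\mathcal V,C,T)$ denotes the cost of the clustering obtained by running this procedure from $C$ for at most $T$ iterations. A discontinuity is a value of $\beta$ at which this piecewise constant function changes value. *)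

theory Defs
  imports "HOL-Analysis.Analysis"
begin

text \<open>The number of points is \<open>card V\<close>. The library's metric space locale asks for
  non-negativity and symmetry also off the carrier; this only fixes irrelevant values of \<open>d\<close>.\<close>

locale clustering_instance = Metric_space V d
  for V :: "'a set" and d :: "'a \<Rightarrow> 'a \<Rightarrow> real" +
  fixes k :: nat
  assumes finite_points: "finite V"
    and clusters_pos: "1 \<le> k"
    and clusters_le: "k \<le> card V"

definition argmin_set :: "('a \<Rightarrow> real) \<Rightarrow> 'a set \<Rightarrow> 'a set" where
  "argmin_set f S = {x. is_arg_min f (\<lambda>x. x \<in> S) x}"

text \<open>Ties, both between equally near centers and between equally good new centers, are resolved
  by an arbitrary choice function \<open>pick\<close> that is fixed once and for all; in particular it depends
  neither on \<open>\<beta>\<close> nor on the iteration.\<close>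

definition tie_breaking :: "'a set \<Rightarrow> ('a set \<Rightarrow> 'a) \<Rightarrow> bool" where
  "tie_breaking V pick \<longleftrightarrow> (\<forall>S. S \<subseteq> V \<and> S \<noteq> {} \<longrightarrow> pick S \<in> S)"

definition voronoi_cell ::
    "'a set \<Rightarrow> ('a \<Rightarrow> 'a \<Rightarrow> real) \<Rightarrow> ('a set \<Rightarrow> 'a) \<Rightarrow> 'a set \<Rightarrow> 'a \<Rightarrow> 'a set" where
  "voronoi_cell V d pick C c = {v \<in> V. pick (argmin_set (\<lambda>c'. d v c') C) = c}"

definition voronoi ::
    "'a set \<Rightarrow> ('a \<Rightarrow> 'a \<Rightarrow> real) \<Rightarrow> ('a set \<Rightarrow> 'a) \<Rightarrow> 'a set \<Rightarrow> 'a set set" where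
  "voronoi V d pick C = voronoi_cell V d pick C ` C"

text \<open>Since \<open>0 powr \<beta> = 0\<close>, the summand for \<open>v = x\<close> vanishes, as it should for \<open>\<beta> \<ge> 1\<close>.\<close>

definition cluster_center ::
    "'a set \<Rightarrow> ('a \<Rightarrow> 'a \<Rightarrow> real) \<Rightarrow> ('a set \<Rightarrow> 'a) \<Rightarrow> real \<Rightarrow> 'a set \<Rightarrow> 'a" where
  "cluster_center V d pick \<beta> A = pick (argmin_set (\<lambda>x. \<Sum>v\<in>A. d x v powr \<beta>) V)"

text \<open>The centers form a set: if two clusters get the same new center, the two centers merge.\<close>

definition new_centers ::
    "'a set \<Rightarrow> ('a \<Rightarrow> 'a \<Rightarrow> real) \<Rightarrow> ('a set \<Rightarrow> 'a) \<Rightarrow> real \<Rightarrow> 'a set \<Rightarrow> 'a set" where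
  "new_centers V d pick \<beta> C = cluster_center V d pick \<beta> ` voronoi V d pick C"

fun lloyd_centers ::
    "'a set \<Rightarrow> ('a \<Rightarrow> 'a \<Rightarrow> real) \<Rightarrow> ('a set \<Rightarrow> 'a) \<Rightarrow> real \<Rightarrow> 'a set \<Rightarrow> nat \<Rightarrow> 'a set" where
  "lloyd_centers V d pick \<beta> C 0 = C"
| "lloyd_centers V d pick \<beta> C (Suc T) =
     (let C' = new_centers V d pick \<beta> C
      in if C' = C then C else lloyd_centers V d pick \<beta> C' T)"

text \<open>The resulting clustering is the one induced by the final centers; \<open>cost\<close> is the cost function
  on clusterings associated with the instance.\<close>

definition lloyds ::
    "'a set \<Rightarrow> ('a \<Rightarrow> 'a \<Rightarrow> real) \<Rightarrow> ('a set set \<Rightarrow> real) \<Rightarrow> ('a set \<Rightarrow> 'a) \<Rightarrow>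
     real \<Rightarrow> 'a set \<Rightarrow> nat \<Rightarrow> real" where
  "lloyds V d cost pick \<beta> C T = cost (voronoi V d pick (lloyd_centers V d pick \<beta> C T))"

definition discontinuities :: "real set \<Rightarrow> (real \<Rightarrow> real) \<Rightarrow> real set" where
  "discontinuities S f = {x \<in> S. \<not> continuous (at x within S) f}"

end

theory Submission
  imports Defs
begin

text \<open>A candidate center beats another one for a cluster \<open>A\<close> according to the sign of a difference of
  two power sums, which is an exponential sum in \<open>\<beta>\<close> with at most \<open>2 |A|\<close> terms. By Rolle's theorem
  it has at most \<open>2 |A|\<close> zeros unless it vanishes identically. The cells of a Voronoi partition are
  disjoint, so one iteration from fixed centers depends on \<open>\<beta>\<close> only through its position relative to
  \<open>(n choose 2) * 2 n = n ^ 3 - n ^ 2\<close> breakpoints. These leave at most \<open>n ^ 3 - n ^ 2 + 1 \<le> n ^ 3\<close>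
  intervals, each of which is cut again by the next iteration; hence \<open>n ^ (3 * T)\<close>. Collecting instead
  the breakpoints of all of the at most \<open>n ^ k\<close> possible sets of centers gives \<open>n ^ (k + 3)\<close>.\<close>

section \<open>Zeros of exponential sums\<close>

text \<open>An infinite set has finite subsets of every size. This allows successors to be taken in
  a finite set of zeros before the whole zero set is known to be finite.\<close>

lemma finite_card_le_of_finite_subsets:
  assumes "\<And>F. finite F \<Longrightarrow> F \<subseteq> A \<Longrightarrow> card F \<le> m"
  shows "finite A \<and> card A \<le> m"
proof -
  have "finite A"
  proof (rule ccontr)
    assume "infinite A"
    then obtain F where "F \<subseteq> A" "finite F" "card F = Suc m"
      using infinite_arbitrarily_large by blast
    then show False using assms[of F] by simp
  qed
  then show ?thesis using assms by blast
qed

text \<open>Rolle's theorem puts a zero of \<open>g'\<close> strictly between any two consecutive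
  zeros of \<open>g\<close>, and these zeros of \<open>g'\<close> are distinct.\<close>

lemma card_zeros_le_card_deriv_zeros:
  fixes g g' :: "real \<Rightarrow> real"
  assumes deriv: "\<And>x. (g has_real_derivative g' x) (at x)"
    and fin: "finite {x. g' x = 0}"
  shows "finite {x. g x = 0} \<and> card {x. g x = 0} \<le> Suc (card {x. g' x = 0})"
proof (rule finite_card_le_of_finite_subsets)
  fix F assume F: "finite F" "F \<subseteq> {x. g x = 0}"
  show "card F \<le> Suc (card {x. g' x = 0})"
  proof (cases "F = {}")
    case False
    \<comment> \<open>Every zero but the largest has a successor; dropping \<open>Max F\<close>
      accounts for the \<open>Suc\<close> in the bound.\<close>
    define G where "G = F - {Max F}"
    define succ where "succ z = Min {w \<in> F. z < w}" for z
    have succ: "succ z \<in> F \<and> z < succ z" if "z \<in> G" for z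
    proof -
      have "z < Max F" using that F(1) by (auto simp: G_def order_less_le)
      then have "{w \<in> F. z < w} \<noteq> {}" using F(1) False Max_in by blast
      then have "succ z \<in> {w \<in> F. z < w}" unfolding succ_def using F(1) by (intro Min_in) auto
      then show ?thesis by simp
    qed
    have succ_le: "succ z \<le> w" if "w \<in> F" "z < w" for z w
      unfolding succ_def using that F(1) by (intro Min_le) auto
    have "\<exists>r. z < r \<and> r < succ z \<and> g' r = 0" if z: "z \<in> G" for z
    proof -
      have "z \<in> {x. g x = 0}" "succ z \<in> {x. g x = 0}"
        using succ[OF z] z F(2) unfolding G_def by blast+
      then have "g z = g (succ z)" by simp
      moreover have "continuous_on {z..succ z} g"
        by (intro continuous_at_imp_continuous_on ballI DERIV_isCont[OF deriv])
      moreover have "(g has_derivative (*) (g' x)) (at x)" for x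
        using deriv[of x] by (simp add: has_field_derivative_def)
      ultimately obtain r where "z < r" "r < succ z" "(*) (g' r) = (\<lambda>v. 0)"
        using Rolle_deriv[of z "succ z" g "\<lambda>x. (*) (g' x)"] succ[OF z] by auto
      then show ?thesis by (metis mult.right_neutral)
    qed
    then obtain r where r: "\<And>z. z \<in> G \<Longrightarrow> z < r z \<and> r z < succ z \<and> g' (r z) = 0"
      by metis
    \<comment> \<open>The Rolle points interlace with the zeros: \<open>r z < succ z\<close>,
      \<open>succ z \<le> w\<close> and \<open>w < r w\<close>.\<close>
    have "r z < r w" if "z \<in> G" "w \<in> G" "z < w" for z w
      using r[OF that(1)] r[OF that(2)] succ_le[of w z] that by (auto simp: G_def)
    then have "strict_mono_on G r" by (simp add: strict_mono_on_def)
    then have "inj_on r G" by (rule strict_mono_on_imp_inj_on)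
    then have "card G \<le> card {x. g' x = 0}"
      using r fin by (intro card_inj_on_le[of r]) auto
    then show ?thesis using F(1) False by (simp add: G_def)
  qed simp
qed

text \<open>Induction on the number of terms: one differentiation removes one term and loses at most
  one zero. Indexing the terms by their exponents builds in that the exponents are distinct.\<close>

lemma card_zeros_exp_sum_distinct:
  fixes a :: "real \<Rightarrow> real"
  assumes "finite S" and "\<exists>s\<in>S. a s \<noteq> 0"
  shows "finite {x. (\<Sum>s\<in>S. a s * exp (s * x)) = 0} \<and>
         card {x. (\<Sum>s\<in>S. a s * exp (s * x)) = 0} < card S"
  using assms
proof (induction S arbitrary: a rule: finite_induct)
  case empty
  then show ?case by simp
next
  case (insert s0 S)
  show ?case
  proof (cases "\<exists>s\<in>S. a s \<noteq> 0")
    case False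
    then have "a s0 \<noteq> 0" "(\<Sum>s\<in>S. a s * exp (s * x)) = 0" for x
      using insert.prems by auto
    then show ?thesis using insert.hyps by simp
  next
    case True
    \<comment> \<open>Dividing by \<open>exp (s0 * x)\<close> makes the \<open>s0\<close>-term constant, so that it vanishes in the derivative.\<close>
    define g where "g x = a s0 + (\<Sum>s\<in>S. a s * exp ((s - s0) * x))" for x
    define g' where "g' x = (\<Sum>s\<in>S. a s * (s - s0) * exp ((s - s0) * x))" for x
    have shift: "(\<Sum>s\<in>S. c s * exp ((s - s0) * x)) = exp (- (s0 * x)) * (\<Sum>s\<in>S. c s * exp (s * x))"
      for c x
      by (simp add: sum_distrib_left left_diff_distrib exp_diff exp_minus field_simps)
    have "g x = exp (- (s0 * x)) * (\<Sum>s\<in>insert s0 S. a s * exp (s * x))" for x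
      using insert.hyps unfolding g_def shift
      by (simp add: distrib_left exp_minus field_simps)
    then have g: "{x. (\<Sum>s\<in>insert s0 S. a s * exp (s * x)) = 0} = {x. g x = 0}"
      by simp
    have g': "{x. g' x = 0} = {x. (\<Sum>s\<in>S. a s * (s - s0) * exp (s * x)) = 0}"
      unfolding g'_def shift by simp
    \<comment> \<open>Since \<open>s0\<close> is not in \<open>S\<close>, the factors
      \<open>s - s0\<close> are nonzero and a nonzero coefficient survives the
      differentiation.\<close>
    have "\<exists>s\<in>S. a s * (s - s0) \<noteq> 0" using True insert.hyps by auto
    then have IH: "finite {x. g' x = 0}" "card {x. g' x = 0} < card S"
      using insert.IH[of "\<lambda>s. a s * (s - s0)"] unfolding g' by auto
    have "(g has_real_derivative g' x) (at x)" for x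
      unfolding g_def g'_def
      by (auto intro!: derivative_eq_intros sum.cong simp: mult_ac)
    then have "finite {x. g x = 0} \<and> card {x. g x = 0} \<le> Suc (card {x. g' x = 0})"
      using IH(1) by (rule card_zeros_le_card_deriv_zeros)
    then show ?thesis using IH(2) insert.hyps unfolding g by simp
  qed
qed

text \<open>Terms with equal exponents are merged first. The value at \<open>y\<close> shows that
  not all merged coefficients cancel, and merging only lowers the number of terms.\<close>

lemma card_zeros_exp_sum:
  fixes c e :: "'i \<Rightarrow> real"
  assumes "finite I" and "(\<Sum>i\<in>I. c i * exp (e i * y)) \<noteq> 0"
  shows "finite {x. (\<Sum>i\<in>I. c i * exp (e i * x)) = 0} \<and>
         card {x. (\<Sum>i\<in>I. c i * exp (e i * x)) = 0} \<le> card I"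
proof -
  define a where "a s = (\<Sum>i\<in>{i\<in>I. e i = s}. c i)" for s
  have eq: "(\<Sum>i\<in>I. c i * exp (e i * x)) = (\<Sum>s\<in>e ` I. a s * exp (s * x))" for x
    unfolding a_def sum_distrib_right
    by (subst sum.image_gen[OF assms(1), of _ e]) (auto intro!: sum.cong)
  have "\<exists>s\<in>e ` I. a s \<noteq> 0"
    using assms(2) unfolding eq by (metis (no_types, lifting) mult_zero_left sum.neutral)
  then show ?thesis
    using card_zeros_exp_sum_distinct[of "e ` I" a] card_image_le[OF assms(1), of e] assms(1)
    unfolding eq by auto
qed

lemma card_zeros_powr_sum:
  fixes c b :: "'i \<Rightarrow> real"
  assumes "finite I" and "(\<Sum>i\<in>I. c i * b i powr y) \<noteq> 0"
  shows "finite {x. (\<Sum>i\<in>I. c i * b i powr x) = 0} \<and>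
         card {x. (\<Sum>i\<in>I. c i * b i powr x) = 0} \<le> card I"
proof -
  \<comment> \<open>A zero base contributes 0 for every exponent; any other base gives an
    exponential with rate \<open>ln (b i)\<close>.\<close>
  define J where "J = {i\<in>I. b i \<noteq> 0}"
  have J: "finite J" "card J \<le> card I"
    using assms(1) by (auto simp: J_def intro: card_mono)
  have eq: "(\<Sum>i\<in>I. c i * b i powr x) = (\<Sum>i\<in>J. c i * exp (ln (b i) * x))" for x
    unfolding J_def using assms(1)
    by (intro sum.mono_neutral_cong_right) (auto simp: powr_def mult_ac)
  show ?thesis
    using card_zeros_exp_sum[OF J(1), of c "\<lambda>i. ln (b i)" y] assms(2) J(2)
    unfolding eq by auto
qed

lemma card_zeros_diff_powr_sums:
  fixes f g :: "'i \<Rightarrow> real"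
  assumes "finite A" and "(\<Sum>v\<in>A. f v powr y) \<noteq> (\<Sum>v\<in>A. g v powr y)"
  shows "finite {x. (\<Sum>v\<in>A. f v powr x) = (\<Sum>v\<in>A. g v powr x)} \<and>
         card {x. (\<Sum>v\<in>A. f v powr x) = (\<Sum>v\<in>A. g v powr x)} \<le> 2 * card A"
proof -
  \<comment> \<open>The difference becomes a single sum over two disjoint copies of
    \<open>A\<close>, with signs 1 and -1; hence \<open>2 * card A\<close> terms.\<close>
  define c where "c = case_sum (\<lambda>_::'i. 1::real) (\<lambda>_::'i. - 1)"
  have eq: "(\<Sum>i\<in>A <+> A. c i * case_sum f g i powr x)
      = (\<Sum>v\<in>A. f v powr x) - (\<Sum>v\<in>A. g v powr x)" for x
    using assms(1) by (simp add: sum.Plus c_def sum_negf)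
  show ?thesis
    using card_zeros_powr_sum[of "A <+> A" c "case_sum f g" y] assms
    unfolding eq by (simp add: card_Plus)
qed

section \<open>Functions that are constant between finitely many breakpoints\<close>

text \<open>Quantifying over connected sets avoids listing the gaps of \<open>B\<close> in order and
  fits the intermediate value theorem. At the points of \<open>B\<close> themselves nothing is
  claimed.\<close>

definition constant_off :: "(real \<Rightarrow> 'b) \<Rightarrow> real set \<Rightarrow> bool" where
  "constant_off f B \<longleftrightarrow>
     (\<forall>I x y. connected I \<longrightarrow> I \<inter> B = {} \<longrightarrow> x \<in> I \<longrightarrow> y \<in> I \<longrightarrow> f x = f y)"

lemma constant_offI:
  assumes "\<And>I x y. connected I \<Longrightarrow> I \<inter> B = {} \<Longrightarrow> x \<in> I \<Longrightarrow> y \<in> I \<Longrightarrow> f x = f y"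
  shows "constant_off f B"
  using assms unfolding constant_off_def by blast

lemma constant_offD:
  assumes "constant_off f B" "connected I" "I \<inter> B = {}" "x \<in> I" "y \<in> I"
  shows "f x = f y"
  using assms unfolding constant_off_def by blast

lemma constant_off_subset: "constant_off f A \<Longrightarrow> A \<subseteq> B \<Longrightarrow> constant_off f B"
  unfolding constant_off_def by blast

lemma constant_off_compose: "constant_off f B \<Longrightarrow> constant_off (\<lambda>x. h (f x)) B"
  unfolding constant_off_def by metis

text \<open>The gap containing \<open>x\<close> is identified by \<open>idx x\<close>, the number of
  breakpoints below \<open>x\<close>, which has only \<open>card B + 1\<close> possible
  values.\<close>

lemma card_image_constant_off:
  assumes "finite B" "constant_off f B"
  shows "finite (f ` (- B)) \<and> card (f ` (- B)) \<le> Suc (card B)"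
proof -
  define idx where "idx x = card {b \<in> B. b < x}" for x
  have mono: "f x = f y" if "x \<in> - B" "y \<in> - B" "idx x = idx y" "x \<le> y" for x y
  proof -
    have same: "{b \<in> B. b < x} = {b \<in> B. b < y}"
      using that assms(1) unfolding idx_def by (intro card_subset_eq) auto
    have "b \<notin> {x..y}" if "b \<in> B" for b
    proof
      assume "b \<in> {x..y}"
      moreover have "b \<noteq> y" using \<open>b \<in> B\<close> \<open>y \<in> - B\<close> by blast
      ultimately have "b \<in> {b \<in> B. b < y}" using \<open>b \<in> B\<close> by simp
      then have "b < x" unfolding same[symmetric] by simp
      then show False using \<open>b \<in> {x..y}\<close> by simp
    qed
    then have "{x..y} \<inter> B = {}" by blast
    then show ?thesis using constant_offD[OF assms(2), of "{x..y}" x y] that by simp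
  qed
  then have eq: "f x = f y" if "x \<in> - B" "y \<in> - B" "idx x = idx y" for x y
    using linear[of x y] mono[OF that] mono[OF that(2,1) that(3)[symmetric]] by presburger
  define r where "r i = f (SOME x. x \<in> - B \<and> idx x = i)" for i
  have "f x = r (idx x)" if "x \<in> - B" for x
  proof -
    have "(SOME z. z \<in> - B \<and> idx z = idx x) \<in> - B \<and> idx (SOME z. z \<in> - B \<and> idx z = idx x) = idx x"
      by (rule someI[of _ x]) (use that in simp)
    then show ?thesis unfolding r_def by (intro eq[OF that]) auto
  qed
  moreover have "idx x \<in> {..card B}" for x
    unfolding idx_def atMost_iff using assms(1) by (intro card_mono) auto
  ultimately have sub: "f ` (- B) \<subseteq> r ` {..card B}" by auto
  have "card (r ` {..card B}) \<le> Suc (card B)"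
    using card_image_le[of "{..card B}" r] by simp
  then show ?thesis
    using le_trans[OF card_mono[OF _ sub]] finite_subset[OF sub] by blast
qed

text \<open>A finite set is closed, so a point outside \<open>B\<close> has a ball free of
  breakpoints, on which \<open>f\<close> is constant.\<close>

lemma discontinuities_subset_constant_off:
  assumes "finite B" "constant_off f B"
  shows "discontinuities {u..} f \<subseteq> B"
proof
  fix x assume x: "x \<in> discontinuities {u..} f"
  show "x \<in> B"
  proof (rule ccontr)
    assume "x \<notin> B"
    then obtain e where e: "e > 0" "ball x e \<inter> B = {}"
      using finite_imp_closed[OF assms(1)] open_contains_ball[of "- B"]
      by (metis Compl_iff disjoint_eq_subset_Compl open_Compl)
    have "f y = f x" if "dist y x < e" for y
      using constant_offD[OF assms(2), of "ball x e" y x] e that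
      by (simp add: dist_commute)
    then have "eventually (\<lambda>y. f y = f x) (at x within {u..})"
      using e(1) unfolding eventually_at by blast
    then have "continuous (at x within {u..}) f"
      unfolding continuous_within by (rule tendsto_eventually)
    then show False using x by (simp add: discontinuities_def)
  qed
qed

section \<open>Breakpoints of one iteration\<close>

definition power_cost :: "('a \<Rightarrow> 'a \<Rightarrow> real) \<Rightarrow> 'a set \<Rightarrow> 'a \<Rightarrow> real \<Rightarrow> real" where
  "power_cost d A x \<beta> = (\<Sum>v\<in>A. d x v powr \<beta>)"

text \<open>Candidates with identical cost functions tie everywhere but never change their order;
  the second conjunct keeps them from making every real a breakpoint.\<close>

definition tie_points :: "('a \<Rightarrow> 'a \<Rightarrow> real) \<Rightarrow> 'a set \<Rightarrow> 'a \<Rightarrow> 'a \<Rightarrow> real set" where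
  "tie_points d A x y =
     {\<beta>. power_cost d A x \<beta> = power_cost d A y \<beta> \<and> power_cost d A x \<noteq> power_cost d A y}"

definition cluster_breaks :: "'a set \<Rightarrow> ('a \<Rightarrow> 'a \<Rightarrow> real) \<Rightarrow> 'a set \<Rightarrow> real set" where
  "cluster_breaks V d A = (\<Union>x\<in>V. \<Union>y\<in>V. tie_points d A x y)"

lemma tie_points_commute: "tie_points d A x y = tie_points d A y x"
  unfolding tie_points_def by auto

lemma card_tie_points:
  assumes "finite A"
  shows "finite (tie_points d A x y) \<and> card (tie_points d A x y) \<le> 2 * card A"
proof (cases "power_cost d A x = power_cost d A y")
  case True
  then show ?thesis by (simp add: tie_points_def)
next
  case False
  then obtain \<beta> where "(\<Sum>v\<in>A. d x v powr \<beta>) \<noteq> (\<Sum>v\<in>A. d y v powr \<beta>)"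
    unfolding power_cost_def by (auto simp: fun_eq_iff)
  then have "finite {\<beta>. power_cost d A x \<beta> = power_cost d A y \<beta>} \<and>
      card {\<beta>. power_cost d A x \<beta> = power_cost d A y \<beta>} \<le> 2 * card A"
    unfolding power_cost_def using assms by (intro card_zeros_diff_powr_sums)
  then show ?thesis using False by (simp add: tie_points_def)
qed

text \<open>Counting unordered pairs matters: it absorbs the factor 2 from the number of zeros, so that the
  bound for \<open>T\<close> iterations has a constant independent of \<open>T\<close>.\<close>

lemma card_cluster_breaks:
  assumes "finite V" "finite A"
  shows "finite (cluster_breaks V d A) \<and>
         card (cluster_breaks V d A) \<le> card V * (card V - 1) * card A"
proof -
  define P where "P = {p. p \<subseteq> V \<and> card p = 2}"
  define Z where "Z p = (\<Union>x\<in>p. \<Union>y\<in>p. tie_points d A x y)" for p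
  have finP: "finite P" and cardP: "card P = card V choose 2"
    using assms(1) n_subsets[OF assms(1), of 2] by (auto simp: P_def)
  have self: "tie_points d A x x = {}" for x by (simp add: tie_points_def)
  have Z: "finite (Z p) \<and> card (Z p) \<le> 2 * card A" if "p \<in> P" for p
  proof -
    obtain x y where "p = {x, y}" using \<open>p \<in> P\<close> by (auto simp: P_def card_2_iff)
    then have "Z p = tie_points d A x y"
      using tie_points_commute[of d A x y] self by (auto simp: Z_def)
    then show ?thesis using card_tie_points[OF assms(2)] by metis
  qed
  have sub: "cluster_breaks V d A \<subseteq> (\<Union>p\<in>P. Z p)"
  proof
    fix \<beta> assume "\<beta> \<in> cluster_breaks V d A"
    then obtain x y where xy: "x \<in> V" "y \<in> V" "\<beta> \<in> tie_points d A x y"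
      by (auto simp: cluster_breaks_def)
    then have "x \<noteq> y" using self by auto
    then have "{x, y} \<in> P" using xy by (simp add: P_def)
    moreover have "\<beta> \<in> Z {x, y}" using xy by (simp add: Z_def)
    ultimately show "\<beta> \<in> (\<Union>p\<in>P. Z p)" by blast
  qed
  have fin: "finite (\<Union>p\<in>P. Z p)" using finP Z by blast
  have "card (\<Union>p\<in>P. Z p) \<le> (\<Sum>p\<in>P. card (Z p))" using finP by (rule card_UN_le)
  also have "\<dots> \<le> (\<Sum>p\<in>P. 2 * card A)" using Z by (intro sum_mono) blast
  also have "\<dots> = (card V choose 2) * 2 * card A" by (simp add: cardP)
  \<comment> \<open>One of two consecutive numbers is even, so the halving inside the binomial
    coefficient is exact.\<close>
  also have "(card V choose 2) * 2 = card V * (card V - 1)"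
    unfolding choose_two by (intro dvd_div_mult_self) (cases "even (card V)"; simp)
  finally show ?thesis
    using card_mono[OF fin sub] finite_subset[OF sub fin] by simp
qed

text \<open>By the intermediate value theorem, the continuous cost difference cannot change sign on
  a connected set without a zero there, and such a zero is a tie point.\<close>

lemma power_cost_less_constant_off:
  assumes "x \<in> V" "y \<in> V"
  shows "constant_off (\<lambda>\<beta>. power_cost d A x \<beta> < power_cost d A y \<beta>) (cluster_breaks V d A)"
proof (cases "power_cost d A x = power_cost d A y")
  case True
  then show ?thesis by (simp add: constant_off_def)
next
  case False
  define h where "h \<beta> = power_cost d A x \<beta> - power_cost d A y \<beta>" for \<beta>
  have "continuous_on I (\<lambda>\<beta>. b powr \<beta>)" for I and b :: real
    by (cases "b = 0") (auto simp: powr_def intro!: continuous_intros)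
  then have cont: "continuous_on I h" for I
    unfolding h_def power_cost_def by (intro continuous_on_diff continuous_on_sum)
  have "\<not> (h \<beta> < 0 \<and> \<not> h \<gamma> < 0)"
    if "connected I" "I \<inter> cluster_breaks V d A = {}" "\<beta> \<in> I" "\<gamma> \<in> I" for I \<beta> \<gamma>
  proof
    assume "h \<beta> < 0 \<and> \<not> h \<gamma> < 0"
    then have "0 \<in> h ` I"
      using connected_continuous_image[OF cont that(1)] that(3,4)
      by (meson connectedD_interval imageI less_imp_le not_less)
    then obtain \<delta> where "\<delta> \<in> I" "h \<delta> = 0" by force
    then have "\<delta> \<in> tie_points d A x y" using False by (simp add: tie_points_def h_def)
    then show False using \<open>\<delta> \<in> I\<close> that(2) assms by (auto simp: cluster_breaks_def)
  qed
  then have "constant_off (\<lambda>\<beta>. h \<beta> < 0) (cluster_breaks V d A)"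
    unfolding constant_off_def by blast
  then show ?thesis by (simp add: h_def)
qed

lemma argmin_set_eq: "argmin_set f S = {x \<in> S. \<not> (\<exists>y\<in>S. f y < f x)}"
  unfolding argmin_set_def is_arg_min_def by blast

text \<open>The set of minimizers is determined by the strict comparisons between candidates, and
  \<open>pick\<close> sees nothing but this set.\<close>

lemma cluster_center_constant_off:
  "constant_off (\<lambda>\<beta>. cluster_center V d pick \<beta> A) (cluster_breaks V d A)"
proof (rule constant_offI)
  fix I \<beta> \<gamma>
  assume "connected I" "I \<inter> cluster_breaks V d A = {}" "\<beta> \<in> I" "\<gamma> \<in> I"
  then have "(power_cost d A x \<beta> < power_cost d A y \<beta>) = (power_cost d A x \<gamma> < power_cost d A y \<gamma>)"
    if "x \<in> V" "y \<in> V" for x y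
    using constant_offD[OF power_cost_less_constant_off[OF that]] by blast
  then have "argmin_set (\<lambda>x. power_cost d A x \<beta>) V = argmin_set (\<lambda>x. power_cost d A x \<gamma>) V"
    unfolding argmin_set_eq by blast
  then show "cluster_center V d pick \<beta> A = cluster_center V d pick \<gamma> A"
    unfolding cluster_center_def power_cost_def by simp
qed

text \<open>The Voronoi step involves only \<open>d\<close>, \<open>C\<close> and
  \<open>pick\<close>, so breakpoints arise only when a center is chosen for each cell.\<close>

definition iteration_breaks ::
    "'a set \<Rightarrow> ('a \<Rightarrow> 'a \<Rightarrow> real) \<Rightarrow> ('a set \<Rightarrow> 'a) \<Rightarrow> 'a set \<Rightarrow> real set" where
  "iteration_breaks V d pick C = (\<Union>c\<in>C. cluster_breaks V d (voronoi_cell V d pick C c))"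

lemma new_centers_constant_off:
  "constant_off (\<lambda>\<beta>. new_centers V d pick \<beta> C) (iteration_breaks V d pick C)"
proof (rule constant_offI)
  fix I \<beta> \<gamma>
  assume I: "connected I" "I \<inter> iteration_breaks V d pick C = {}" "\<beta> \<in> I" "\<gamma> \<in> I"
  have "cluster_center V d pick \<beta> A = cluster_center V d pick \<gamma> A"
    if "A \<in> voronoi V d pick C" for A
  proof (rule constant_offD[OF cluster_center_constant_off])
    show "I \<inter> cluster_breaks V d A = {}"
      using I(2) that by (auto simp: iteration_breaks_def voronoi_def)
  qed (use I in auto)
  then show "new_centers V d pick \<beta> C = new_centers V d pick \<gamma> C"
    unfolding new_centers_def by (intro image_cong) auto
qed

text \<open>Through \<open>pick\<close> each point belongs to the cell of only one center.
  Disjointness saves a factor \<open>k\<close> in the count of breakpoints.\<close>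

lemma sum_card_voronoi_cell_le:
  assumes "finite V" "finite C"
  shows "(\<Sum>c\<in>C. card (voronoi_cell V d pick C c)) \<le> card V"
proof -
  have "(\<Sum>c\<in>C. card (voronoi_cell V d pick C c)) = card (\<Union>c\<in>C. voronoi_cell V d pick C c)"
    using assms by (intro card_UN_disjoint[symmetric]) (auto simp: voronoi_cell_def)
  also have "\<dots> \<le> card V" using assms(1) by (intro card_mono) (auto simp: voronoi_cell_def)
  finally show ?thesis .
qed

lemma card_iteration_breaks:
  assumes "finite V" "finite C"
  shows "finite (iteration_breaks V d pick C) \<and>
         card (iteration_breaks V d pick C) \<le> card V * (card V - 1) * card V"
proof -
  let ?A = "voronoi_cell V d pick C"
  have A: "finite (?A c)" for c using assms(1) by (simp add: voronoi_cell_def)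
  have "card (iteration_breaks V d pick C) \<le> (\<Sum>c\<in>C. card (cluster_breaks V d (?A c)))"
    unfolding iteration_breaks_def using assms(2) by (rule card_UN_le)
  also have "\<dots> \<le> (\<Sum>c\<in>C. card V * (card V - 1) * card (?A c))"
    using card_cluster_breaks[OF assms(1) A] by (intro sum_mono) blast
  also have "\<dots> \<le> card V * (card V - 1) * card V"
    using sum_card_voronoi_cell_le[OF assms] by (simp add: sum_distrib_left[symmetric])
  finally show ?thesis
    using assms(2) card_cluster_breaks[OF assms(1) A] by (simp add: iteration_breaks_def)
qed

text \<open>Strictness matters: fewer than \<open>card V ^ 3\<close> breakpoints leave at most
  \<open>card V ^ 3\<close> gaps, so gap counts multiply over the iterations without extra
  constants.\<close>

lemma card_iteration_breaks_less:
  assumes "finite V" "V \<noteq> {}" "finite C"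
  shows "card (iteration_breaks V d pick C) < card V ^ 3"
proof -
  have "card V * (card V - 1) * card V < card V ^ 3"
    using assms(1,2) by (simp add: power3_eq_cube card_gt_0_iff)
  then show ?thesis using card_iteration_breaks[OF assms(1,3), of d pick] by linarith
qed

section \<open>Breakpoints of the whole run\<close>

lemma finite_new_centers: "finite C \<Longrightarrow> finite (new_centers V d pick \<beta> C)"
  by (simp add: new_centers_def voronoi_def)

text \<open>The first iteration yields one set of new centers per gap, and the breakpoints of the
  remaining run from each of these sets are added. For \<open>T = 0\<close> the strict bound says
  that there are none.\<close>

lemma lloyd_centers_constant_off_power_iterations:
  assumes V: "finite V" "V \<noteq> {}" and "finite C"
  shows "\<exists>B. finite B \<and> card B < card V ^ (3 * T) \<and>
             constant_off (\<lambda>\<beta>. lloyd_centers V d pick \<beta> C T) B"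
  using assms(3)
proof (induction T arbitrary: C)
  case 0
  then show ?case by (intro exI[of _ "{}"]) (simp add: constant_off_def)
next
  case (Suc T)
  define M where "M = card V ^ 3"
  define m where "m = card V ^ (3 * T)"
  define B0 where "B0 = iteration_breaks V d pick C"
  define N where "N = (\<lambda>\<beta>. new_centers V d pick \<beta> C) ` (- B0)"
  have "finite B0" "card B0 < M"
    using card_iteration_breaks[OF V(1) Suc.prems] card_iteration_breaks_less[OF V Suc.prems]
    by (simp_all add: B0_def M_def)
  have const: "constant_off (\<lambda>\<beta>. new_centers V d pick \<beta> C) B0"
    unfolding B0_def by (rule new_centers_constant_off)
  have N: "finite N" "card N \<le> M"
    using card_image_constant_off[OF \<open>finite B0\<close> const] \<open>card B0 < M\<close> by (auto simp: N_def)
  have "\<forall>C'\<in>N. \<exists>B. finite B \<and> card B < m \<and> constant_off (\<lambda>\<beta>. lloyd_centers V d pick \<beta> C' T) B"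
    using Suc.IH finite_new_centers[OF Suc.prems] by (auto simp: N_def m_def)
  then obtain B where B: "\<And>C'. C' \<in> N \<Longrightarrow> finite (B C') \<and> card (B C') < m \<and>
      constant_off (\<lambda>\<beta>. lloyd_centers V d pick \<beta> C' T) (B C')"
    by metis
  define B1 where "B1 = B0 \<union> (\<Union>C'\<in>N. B C')"
  have "finite B1" using \<open>finite B0\<close> N(1) B by (simp add: B1_def)
  moreover have "card B1 < card V ^ (3 * Suc T)"
  proof -
    have "0 < m" using V by (simp add: m_def card_gt_0_iff)
    have "card (\<Union>C'\<in>N. B C') \<le> (\<Sum>C'\<in>N. card (B C'))" using N(1) by (rule card_UN_le)
    also have "\<dots> \<le> (\<Sum>C'\<in>N. m - 1)" using B by (intro sum_mono) force
    also have "\<dots> \<le> M * (m - 1)" using N(2) by simp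
    \<comment> \<open>Fewer than \<open>M\<close> breakpoints come from the first iteration, and at
      most \<open>m - 1\<close> from each of at most \<open>M\<close> continuations.\<close>
    finally have "card B1 < M + M * (m - 1)"
      using card_Un_le[of B0 "\<Union>C'\<in>N. B C'"] \<open>card B0 < M\<close> unfolding B1_def by linarith
    also have "\<dots> = M * m" using \<open>0 < m\<close> by (cases m) auto
    finally show ?thesis by (simp add: M_def m_def power_add)
  qed
  moreover have "constant_off (\<lambda>\<beta>. lloyd_centers V d pick \<beta> C (Suc T)) B1"
  proof (rule constant_offI)
    fix I \<beta> \<gamma> assume I: "connected I" "I \<inter> B1 = {}" "\<beta> \<in> I" "\<gamma> \<in> I"
    define C' where "C' = new_centers V d pick \<beta> C"
    have new: "new_centers V d pick \<gamma> C = C'"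
      unfolding C'_def using const I by (intro constant_offD[of _ B0 I]) (auto simp: B1_def)
    have "C' \<in> N" using I by (auto simp: N_def C'_def B1_def)
    then have "lloyd_centers V d pick \<beta> C' T = lloyd_centers V d pick \<gamma> C' T"
      using B[of C'] I by (intro constant_offD[of _ "B C'" I]) (auto simp: B1_def)
    then show "lloyd_centers V d pick \<beta> C (Suc T) = lloyd_centers V d pick \<gamma> C (Suc T)"
      using new by (simp add: C'_def[symmetric])
  qed
  ultimately show ?case by blast
qed

section \<open>A bound by the number of possible center sets\<close>

definition center_sets :: "'a set \<Rightarrow> nat \<Rightarrow> 'a set set" where
  "center_sets V k = {S. S \<subseteq> V \<and> S \<noteq> {} \<and> card S \<le> k}"

text \<open>Each such set is the range of a map from \<open>{..<k}\<close> to \<open>V\<close>.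
  Sizes below \<open>k\<close> have to be counted because centers may merge.\<close>

lemma card_center_sets:
  assumes "finite V"
  shows "finite (center_sets V k) \<and> card (center_sets V k) \<le> card V ^ k"
proof -
  define F where "F = {..<k} \<rightarrow>\<^sub>E V"
  have F: "finite F" "card F = card V ^ k"
    using assms by (auto simp: F_def finite_PiE card_PiE)
  have sub: "center_sets V k \<subseteq> (\<lambda>f. f ` {..<k}) ` F"
  proof
    fix S assume S: "S \<in> center_sets V k"
    then have "finite S" using assms finite_subset by (auto simp: center_sets_def)
    then obtain g where g: "bij_betw g {..<card S} S"
      by (metis atLeast0LessThan ex_bij_betw_nat_finite)
    obtain s where "s \<in> S" using S by (auto simp: center_sets_def)
    \<comment> \<open>The enumeration of \<open>S\<close> is padded with a fixed element
      \<open>s\<close> up to length \<open>k\<close>; \<open>restrict\<close> makes it extensional,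
      as membership in \<open>F\<close> demands.\<close>
    define f where "f = restrict (\<lambda>i. if i < card S then g i else s) {..<k}"
    have f: "f ` {..<k} = S"
    proof
      show "f ` {..<k} \<subseteq> S"
        using \<open>s \<in> S\<close> bij_betw_apply[OF g] by (auto simp: f_def)
      show "S \<subseteq> f ` {..<k}"
      proof
        fix x assume "x \<in> S"
        then have "x \<in> g ` {..<card S}" using bij_betw_imp_surj_on[OF g] by simp
        then obtain i where "i < card S" "g i = x" by blast
        then show "x \<in> f ` {..<k}"
          using S by (intro image_eqI[of _ _ i]) (auto simp: f_def center_sets_def)
      qed
    qed
    have "f ` {..<k} \<subseteq> V" using S f by (simp add: center_sets_def)
    then have "f \<in> F" unfolding F_def by (intro PiE_I) (auto simp: f_def)
    then show "S \<in> (\<lambda>f. f ` {..<k}) ` F" using f by blast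
  qed
  show ?thesis
    using finite_subset[OF sub finite_imageI[OF F(1)]] surj_card_le[OF F(1) sub] F(2) by simp
qed

lemma argmin_set_nonempty:
  assumes "finite S" "S \<noteq> {}"
  shows "argmin_set f S \<noteq> {}"
  using ex_is_arg_min_if_finite[OF assms, of f] by (auto simp: argmin_set_def)

lemma new_centers_in_center_sets:
  assumes "finite V" "tie_breaking V pick" "C \<in> center_sets V k"
  shows "new_centers V d pick \<beta> C \<in> center_sets V k"
proof -
  have C: "C \<subseteq> V" "C \<noteq> {}" "card C \<le> k" "finite C" "V \<noteq> {}"
    using assms finite_subset by (auto simp: center_sets_def)
  have "cluster_center V d pick \<beta> A \<in> V" for A
  proof -
    let ?S = "argmin_set (\<lambda>x. \<Sum>v\<in>A. d x v powr \<beta>) V"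
    have "?S \<subseteq> V" by (auto simp: argmin_set_eq)
    moreover have "?S \<noteq> {}" using assms(1) C(5) by (rule argmin_set_nonempty)
    ultimately show ?thesis
      using assms(2) unfolding tie_breaking_def cluster_center_def by blast
  qed
  moreover have "card (new_centers V d pick \<beta> C) \<le> card C"
    unfolding new_centers_def voronoi_def image_image using C(4) by (rule card_image_le)
  ultimately show ?thesis
    using C by (auto simp: center_sets_def new_centers_def voronoi_def)
qed

text \<open>Every set of centers met during the run stays in \<open>center_sets V k\<close>, so one
  breakpoint set serves all iterations and does not depend on \<open>T\<close>.\<close>

lemma lloyd_centers_constant_off_center_sets:
  assumes "finite V" "tie_breaking V pick" "C \<in> center_sets V k"
  shows "constant_off (\<lambda>\<beta>. lloyd_centers V d pick \<beta> C T)
           (\<Union>S\<in>center_sets V k. iteration_breaks V d pick S)"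
  using assms(3)
proof (induction T arbitrary: C)
  case 0
  then show ?case by (simp add: constant_off_def)
next
  case (Suc T)
  let ?B = "\<Union>S\<in>center_sets V k. iteration_breaks V d pick S"
  show ?case
  proof (rule constant_offI)
    fix I \<beta> \<gamma> assume I: "connected I" "I \<inter> ?B = {}" "\<beta> \<in> I" "\<gamma> \<in> I"
    define C' where "C' = new_centers V d pick \<beta> C"
    have "constant_off (\<lambda>\<beta>. new_centers V d pick \<beta> C) ?B"
      using Suc.prems by (intro constant_off_subset[OF new_centers_constant_off]) blast
    then have new: "new_centers V d pick \<gamma> C = C'"
      unfolding C'_def by (rule constant_offD) (use I in auto)
    have "C' \<in> center_sets V k"
      unfolding C'_def using assms(1,2) Suc.prems by (rule new_centers_in_center_sets)
    then have "lloyd_centers V d pick \<beta> C' T = lloyd_centers V d pick \<gamma> C' T"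
      using I by (intro constant_offD[OF Suc.IH])
    then show "lloyd_centers V d pick \<beta> C (Suc T) = lloyd_centers V d pick \<gamma> C (Suc T)"
      using new by (simp add: C'_def[symmetric])
  qed
qed

lemma card_breaks_center_sets:
  assumes "finite V" "V \<noteq> {}"
  shows "finite (\<Union>S\<in>center_sets V k. iteration_breaks V d pick S) \<and>
         card (\<Union>S\<in>center_sets V k. iteration_breaks V d pick S) \<le> card V ^ (k + 3)"
proof -
  let ?S = "center_sets V k"
  have S: "finite ?S" "card ?S \<le> card V ^ k" using card_center_sets[OF assms(1)] by auto
  have fin: "finite S" if "S \<in> ?S" for S
    using that assms(1) finite_subset by (auto simp: center_sets_def)
  have "card (\<Union>S\<in>?S. iteration_breaks V d pick S) \<le> (\<Sum>S\<in>?S. card (iteration_breaks V d pick S))"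
    using S(1) by (rule card_UN_le)
  also have "\<dots> \<le> (\<Sum>S\<in>?S. card V ^ 3)"
    by (intro sum_mono less_imp_le card_iteration_breaks_less[OF assms] fin)
  also have "\<dots> \<le> card V ^ k * card V ^ 3" using S(2) by simp
  finally show ?thesis
    using S(1) card_iteration_breaks[OF assms(1) fin] by (simp add: power_add)
qed

theorem theorem5:
  "\<exists>K::real. \<forall>(T::nat) (n::nat) (k::nat) (V::'a set) (d :: 'a \<Rightarrow> 'a \<Rightarrow> real)
      (cost :: 'a set set \<Rightarrow> real) (pick :: 'a set \<Rightarrow> 'a) (C :: 'a set).
     clustering_instance V d k \<and> card V = n \<and> tie_breaking V pick \<and> C \<subseteq> V \<and> card C = k \<longrightarrow>
       finite (discontinuities {1..} (\<lambda>\<beta>. lloyds V d cost pick \<beta> C T)) \<and>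
       real (card (discontinuities {1..} (\<lambda>\<beta>. lloyds V d cost pick \<beta> C T)))
         \<le> K * min (real n ^ (3 * T)) (real n ^ (k + 3))"
proof (intro exI[of _ 1] allI impI, elim conjE)
  fix T n k :: nat and V :: "'a set" and d :: "'a \<Rightarrow> 'a \<Rightarrow> real"
    and cost :: "'a set set \<Rightarrow> real" and pick :: "'a set \<Rightarrow> 'a" and C :: "'a set"
  assume inst: "clustering_instance V d k" and n: "card V = n" and pick: "tie_breaking V pick"
    and C: "C \<subseteq> V" "card C = k"
  let ?D = "discontinuities {1..} (\<lambda>\<beta>. lloyds V d cost pick \<beta> C T)"
  have V: "finite V" "V \<noteq> {}" and "1 \<le> k"
    using clustering_instance.finite_points[OF inst] clustering_instance.clusters_pos[OF inst]
      clustering_instance.clusters_le[OF inst] by auto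
  have "finite C" using C(1) V(1) finite_subset by blast
  have "C \<in> center_sets V k" using C \<open>1 \<le> k\<close> by (auto simp: center_sets_def)
  \<comment> \<open>The final clustering and its cost are functions of the final centers, so either
    breakpoint set for the centers contains all discontinuities.\<close>
  have sub: "?D \<subseteq> B" if "finite B" "constant_off (\<lambda>\<beta>. lloyd_centers V d pick \<beta> C T) B" for B
    unfolding lloyds_def
    using that(1) constant_off_compose[OF that(2)] by (rule discontinuities_subset_constant_off)
  obtain B where B: "finite B" "card B < n ^ (3 * T)"
    "constant_off (\<lambda>\<beta>. lloyd_centers V d pick \<beta> C T) B"
    using lloyd_centers_constant_off_power_iterations[OF V \<open>finite C\<close>] n by metis
  have D: "finite ?D" "card ?D \<le> n ^ (3 * T)"
    using finite_subset[OF sub[OF B(1,3)] B(1)] card_mono[OF B(1) sub[OF B(1,3)]] B(2)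
    by simp_all
  let ?B = "\<Union>S\<in>center_sets V k. iteration_breaks V d pick S"
  have fin: "finite ?B" and card: "card ?B \<le> n ^ (k + 3)"
    using card_breaks_center_sets[OF V] n by auto
  have "constant_off (\<lambda>\<beta>. lloyd_centers V d pick \<beta> C T) ?B"
    using V(1) pick \<open>C \<in> center_sets V k\<close> by (rule lloyd_centers_constant_off_center_sets)
  then have "card ?D \<le> n ^ (k + 3)"
    using card_mono[OF fin sub[OF fin]] card by simp
  then have "real (card ?D) \<le> 1 * min (real n ^ (3 * T)) (real n ^ (k + 3))"
    using D(2) by (simp flip: of_nat_power)
  with D(1) show "finite ?D \<and> real (card ?D) \<le> 1 * min (real n ^ (3 * T)) (real n ^ (k + 3))"
    by blast
qed

end
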